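(* For all integers $k,d\ge 2$, the generic $k$-rank of binary forms of degree $kd$ is $$\mathrm{rk}^\circ_k(2,kd)=\left\lceil\frac{kd+1}{d+1}\right\rceil .$$
   Context: All forms have complex coefficients. A binary form is a homogeneous polynomial in $\mathbb{C}[x,y]$. For a binary form $f$ of degree $kd$, the $k$-rank of $f$ is the smallest $s$ such that $f=g_1^k+\dots+g_s^k$ for some binary forms $g_1,\dots,g_s$ of degree $d$. The generic $k$-rank $\mathrm{rk}^\circ_k(2,kd)$ is the $k$-rank of a general binary form of degree $kd$; equivalently, it is the smallest $s$ such that the set of forms $g_1^k+\dots+g_s^k$ (with $g_1,\dots,g_s$ binary forms of degree $d$) is Zariski dense in the vector space of binary forms of degree $kd$. *)

theory Defs
  imports "HOL-Analysis.Analysis" "HOL-Computational_Algebra.Polynomial"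
begin

text \<open>
  The ring \<open>\<complex>[x,y]\<close> is rendered as \<^typ>\<open>complex poly poly\<close>, i.e. \<open>\<complex>[x][y]\<close>: the coefficient of
  \<open>x\<^sup>i y\<^sup>j\<close> in \<open>f\<close> is \<open>coeff (coeff f j) i\<close>. As usual, the zero polynomial is a form of
  every degree, so that the forms of degree \<open>n\<close> are a vector space.
\<close>

definition binary_forms :: "nat \<Rightarrow> complex poly poly set" where
  "binary_forms n = {f. \<forall>i j. coeff (coeff f j) i \<noteq> 0 \<longrightarrow> i + j = n}"

definition sums_of_powers :: "nat \<Rightarrow> nat \<Rightarrow> nat \<Rightarrow> complex poly poly set" where
  "sums_of_powers k d s = {f. \<exists>g. (\<forall>i<s. g i \<in> binary_forms d) \<and> f = (\<Sum>i<s. g i ^ k)}"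

text \<open>
  Polynomial functions in the coefficients of a form. They are given on all of \<open>\<complex>[x,y]\<close>;
  on the space of forms of degree \<open>n\<close> only the coefficients of \<open>x\<^sup>i y\<^sup>j\<close> with
  \<open>i + j = n\<close> can be nonzero, and these are the linear coordinates of that space.
\<close>

inductive_set coeff_polynomials :: "(complex poly poly \<Rightarrow> complex) set" where
  const: "(\<lambda>f. c) \<in> coeff_polynomials"
| coordinate: "(\<lambda>f. coeff (coeff f j) i) \<in> coeff_polynomials"
| add: "P \<in> coeff_polynomials \<Longrightarrow> Q \<in> coeff_polynomials \<Longrightarrow> (\<lambda>f. P f + Q f) \<in> coeff_polynomials"
| mult: "P \<in> coeff_polynomials \<Longrightarrow> Q \<in> coeff_polynomials \<Longrightarrow> (\<lambda>f. P f * Q f) \<in> coeff_polynomials"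

definition zariski_closed :: "nat \<Rightarrow> complex poly poly set \<Rightarrow> bool" where
  "zariski_closed n Z \<longleftrightarrow>
     (\<exists>\<P> \<subseteq> coeff_polynomials. Z = {f \<in> binary_forms n. \<forall>P\<in>\<P>. P f = 0})"

definition zariski_topology :: "nat \<Rightarrow> complex poly poly topology" where
  "zariski_topology n =
     topology (\<lambda>U. U \<subseteq> binary_forms n \<and> zariski_closed n (binary_forms n - U))"

lemma istopology_zariski:
  "istopology (\<lambda>U. U \<subseteq> binary_forms n \<and> zariski_closed n (binary_forms n - U))"
proof -
  have inter: "zariski_closed n (binary_forms n - (S \<inter> T))"
    if S: "zariski_closed n (binary_forms n - S)" and T: "zariski_closed n (binary_forms n - T)"
    for S T
  proof -
    obtain A where A: "A \<subseteq> coeff_polynomials"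
      "binary_forms n - S = {f \<in> binary_forms n. \<forall>P\<in>A. P f = 0}"
      using S unfolding zariski_closed_def by blast
    obtain B where B: "B \<subseteq> coeff_polynomials"
      "binary_forms n - T = {f \<in> binary_forms n. \<forall>P\<in>B. P f = 0}"
      using T unfolding zariski_closed_def by blast
    define C where "C = {(\<lambda>f. P f * Q f) | P Q. P \<in> A \<and> Q \<in> B}"
    have "C \<subseteq> coeff_polynomials"
      using A(1) B(1) by (auto simp: C_def intro!: coeff_polynomials.mult)
    moreover have "binary_forms n - (S \<inter> T) = {f \<in> binary_forms n. \<forall>P\<in>C. P f = 0}"
    proof -
      have "(\<forall>R\<in>C. R f = 0) \<longleftrightarrow> (\<forall>P\<in>A. P f = 0) \<or> (\<forall>P\<in>B. P f = 0)" for f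
      proof
        assume R: "\<forall>R\<in>C. R f = 0"
        have "P f * Q f = 0" if "P \<in> A" "Q \<in> B" for P Q
        proof -
          have "(\<lambda>f. P f * Q f) \<in> C" unfolding C_def using that by blast
          from bspec[OF R this] show ?thesis .
        qed
        then show "(\<forall>P\<in>A. P f = 0) \<or> (\<forall>P\<in>B. P f = 0)"
          by (metis mult_eq_0_iff)
      qed (auto simp: C_def)
      then have "{f \<in> binary_forms n. \<forall>P\<in>C. P f = 0} =
          {f \<in> binary_forms n. \<forall>P\<in>A. P f = 0} \<union> {f \<in> binary_forms n. \<forall>P\<in>B. P f = 0}"
        by blast
      then show ?thesis by (simp only: A(2)[symmetric] B(2)[symmetric] Diff_Int)
    qed
    ultimately show ?thesis unfolding zariski_closed_def by (intro exI conjI)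
  qed
  have union: "zariski_closed n (binary_forms n - \<Union>K)"
    if K: "\<forall>U\<in>K. zariski_closed n (binary_forms n - U)" for K
  proof -
    have "\<forall>U\<in>K. \<exists>\<P>. \<P> \<subseteq> coeff_polynomials \<and>
        binary_forms n - U = {f \<in> binary_forms n. \<forall>P\<in>\<P>. P f = 0}"
      using K unfolding zariski_closed_def .
    from bchoice[OF this] obtain A where A: "\<forall>U\<in>K. A U \<subseteq> coeff_polynomials \<and>
        binary_forms n - U = {f \<in> binary_forms n. \<forall>P\<in>A U. P f = 0}" ..
    have "(\<Union>U\<in>K. A U) \<subseteq> coeff_polynomials" using A by blast
    moreover have "binary_forms n - \<Union>K =
        {f \<in> binary_forms n. \<forall>P\<in>(\<Union>U\<in>K. A U). P f = 0}"
    proof -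
      have "f \<notin> U \<longleftrightarrow> (\<forall>P\<in>A U. P f = 0)" if "U \<in> K" "f \<in> binary_forms n" for U f
        using bspec[OF A that(1)] that(2) by blast
      then show ?thesis by auto
    qed
    ultimately show ?thesis unfolding zariski_closed_def by (intro exI conjI)
  qed
  show ?thesis
    unfolding istopology_def
  proof (intro conjI allI impI)
    fix S T
    assume "S \<subseteq> binary_forms n \<and> zariski_closed n (binary_forms n - S)"
      and "T \<subseteq> binary_forms n \<and> zariski_closed n (binary_forms n - T)"
    then show "S \<inter> T \<subseteq> binary_forms n" "zariski_closed n (binary_forms n - S \<inter> T)"
      using inter by auto
  next
    fix K
    assume "\<forall>U\<in>K. U \<subseteq> binary_forms n \<and> zariski_closed n (binary_forms n - U)"
    then show "\<Union>K \<subseteq> binary_forms n" "zariski_closed n (binary_forms n - \<Union>K)"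
      using union by auto
  qed
qed

lemma openin_zariski:
  "openin (zariski_topology n) U \<longleftrightarrow>
     U \<subseteq> binary_forms n \<and> zariski_closed n (binary_forms n - U)"
  unfolding zariski_topology_def using istopology_zariski by (simp add: topology_inverse')

lemma topspace_zariski: "topspace (zariski_topology n) = binary_forms n"
proof -
  have "zariski_closed n {}"
    unfolding zariski_closed_def
    by (rule exI[of _ "{\<lambda>f. 1}"]) (auto intro: coeff_polynomials.const)
  then have "openin (zariski_topology n) (binary_forms n)"
    by (simp add: openin_zariski)
  then show ?thesis
    by (meson openin_subset openin_topspace openin_zariski subset_antisym)
qed

lemma closedin_zariski: "closedin (zariski_topology n) Z \<longleftrightarrow> zariski_closed n Z"
proof -
  have "zariski_closed n Z \<Longrightarrow> Z \<subseteq> binary_forms n"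
    unfolding zariski_closed_def by blast
  then show ?thesis
    unfolding closedin_def topspace_zariski openin_zariski
    by (auto simp: double_diff)
qed

definition zariski_dense :: "nat \<Rightarrow> complex poly poly set \<Rightarrow> bool" where
  "zariski_dense n S \<longleftrightarrow> S \<subseteq> binary_forms n \<and> zariski_topology n closure_of S = binary_forms n"

definition generic_rank :: "nat \<Rightarrow> nat \<Rightarrow> nat" where
  "generic_rank k d = (LEAST s. zariski_dense (k * d) (sums_of_powers k d s))"

end

theory Submission
  imports Defs
begin

text \<open>
  Write \<open>n = k d\<close>. The forms of degree \<open>n\<close> make up a space of dimension \<open>n + 1\<close>, and \<open>s\<close> forms of
  degree \<open>d\<close> have \<open>s (d + 1)\<close> coefficients. The theorem says that this parameter count is the
  only obstruction: the sums of \<open>s\<close> powers are dense exactly if \<open>n + 1 \<le> s (d + 1)\<close>.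

  \<^emph>\<open>Too few parameters\<close> (\<open>sums_of_powers_not_dense\<close>). The \<open>n + 1\<close> coefficients of
  \<open>g\<^sub>1\<^sup>k + \<dots> + g\<^sub>s\<^sup>k\<close> are polynomials in fewer than \<open>n + 1\<close> parameters, so
  they are algebraically dependent (\<open>algebraically_dependent\<close>). The relation is a nonzero
  polynomial function of the coefficients of a form which vanishes on all sums of \<open>s\<close> powers.

  \<^emph>\<open>Enough parameters\<close> (\<open>sums_of_powers_dense\<close>). This is Terracini's argument. The differential of
  \<open>(g\<^sub>i) \<mapsto> \<Sum> g\<^sub>i\<^sup>k\<close> is \<open>(h\<^sub>i) \<mapsto> k \<Sum> h\<^sub>i g\<^sub>i\<^sup>k\<^sup>-\<^sup>1\<close>. If it is onto at a single
  point, then a polynomial \<open>P\<close> that vanishes on the image is zero: the lowest nonzero homogeneous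
  part of \<open>P\<close> at that point of the image would vanish on the image of the differential, which is
  everything (\<open>vanishes_if_curves_in_all_directions\<close>).

  The point chosen is \<open>g\<^sub>i = (y + c\<^sub>i x)\<^sup>d\<close> with distinct \<open>c\<^sub>i\<close>. There the image of the
  differential consists of the forms \<open>\<Sum> h\<^sub>i (y + c\<^sub>i x)\<^sup>n\<^sup>-\<^sup>d\<close>, the sum of the osculating spaces of
  order \<open>d\<close> of the rational normal curve \<open>c \<mapsto> (y + c x)\<^sup>n\<close> at the points \<open>c\<^sub>i\<close>. A linear functional
  \<open>\<phi>\<close> that kills it gives a polynomial \<open>c \<mapsto> \<phi> ((y + c x)\<^sup>n)\<close> of degree at most \<open>n\<close> which
  vanishes to order \<open>d + 1\<close> at \<open>s\<close> points. As \<open>s (d + 1) > n\<close>, this polynomial is zero, and its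
  coefficients are up to nonzero factors the values of \<open>\<phi>\<close> on the monomials; hence \<open>\<phi> = 0\<close>
  (\<open>powers_of_lines_span\<close>).
\<close>

section \<open>Binary forms and density\<close>

lemma binary_formsD: "f \<in> binary_forms n \<Longrightarrow> i + j \<noteq> n \<Longrightarrow> coeff (coeff f j) i = 0"
  unfolding binary_forms_def by blast

lemma zero_in_binary_forms: "0 \<in> binary_forms n"
  by (simp add: binary_forms_def)

lemma one_in_binary_forms: "1 \<in> binary_forms 0"
  by (auto simp: binary_forms_def coeff_1 split: if_splits)

lemma add_in_binary_forms:
  "f \<in> binary_forms n \<Longrightarrow> g \<in> binary_forms n \<Longrightarrow> f + g \<in> binary_forms n"
  unfolding binary_forms_def by (simp, metis add.right_neutral)

lemma smult_in_binary_forms: "f \<in> binary_forms n \<Longrightarrow> smult [:c:] f \<in> binary_forms n"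
  by (simp add: binary_forms_def)

lemma diff_in_binary_forms:
  "f \<in> binary_forms n \<Longrightarrow> g \<in> binary_forms n \<Longrightarrow> f - g \<in> binary_forms n"
  unfolding binary_forms_def by (simp, metis diff_zero)

lemma sum_in_binary_forms:
  "(\<And>i. i \<in> A \<Longrightarrow> f i \<in> binary_forms n) \<Longrightarrow> (\<Sum>i\<in>A. f i) \<in> binary_forms n"
  by (induction A rule: infinite_finite_induct) (auto intro: zero_in_binary_forms add_in_binary_forms)

lemma coeff_coeff_mult:
  "coeff (coeff (f * g) j) i =
     (\<Sum>b\<le>j. \<Sum>a\<le>i. coeff (coeff f b) a * coeff (coeff g (j - b)) (i - a))"
  by (simp add: coeff_mult coeff_sum)

lemma mult_in_binary_forms:
  assumes f: "f \<in> binary_forms m" and g: "g \<in> binary_forms n"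
  shows "f * g \<in> binary_forms (m + n)"
  unfolding binary_forms_def
proof (intro CollectI allI impI)
  fix i j
  assume "coeff (coeff (f * g) j) i \<noteq> 0"
  then obtain b where b: "b \<le> j"
      "(\<Sum>a\<le>i. coeff (coeff f b) a * coeff (coeff g (j - b)) (i - a)) \<noteq> 0"
    unfolding coeff_coeff_mult by (metis (no_types, lifting) atMost_iff sum.neutral)
  then obtain a where a: "a \<le> i" "coeff (coeff f b) a * coeff (coeff g (j - b)) (i - a) \<noteq> 0"
    by (metis (no_types, lifting) atMost_iff sum.neutral)
  have "a + b = m" "i - a + (j - b) = n"
    using a(2) binary_formsD[OF f, of a b] binary_formsD[OF g, of "i - a" "j - b"] by auto
  with a(1) b(1) show "i + j = m + n" by linarith
qed

lemma power_in_binary_forms: "f \<in> binary_forms d \<Longrightarrow> f ^ k \<in> binary_forms (k * d)"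
  by (induction k) (auto intro: one_in_binary_forms mult_in_binary_forms)

text \<open>
  The form with prescribed coefficients: \<open>a j\<close> is the coefficient of \<open>x\<^sup>n\<^sup>-\<^sup>j y\<^sup>j\<close>, so that the forms of
  degree \<open>n\<close> are parametrised by their \<open>n + 1\<close> coordinates.
\<close>

definition form_of :: "nat \<Rightarrow> (nat \<Rightarrow> complex) \<Rightarrow> complex poly poly" where
  "form_of n a = (\<Sum>j\<le>n. monom (monom (a j) (n - j)) j)"

lemma coeff_form_of:
  "coeff (coeff (form_of n a) j) i = (if i + j = n then a j else 0)"
proof -
  have "coeff (coeff (form_of n a) j) i = (\<Sum>b\<le>n. if b = j then coeff (monom (a j) (n - j)) i else 0)"
    unfolding form_of_def coeff_sum by (intro sum.cong) auto
  also have "\<dots> = (if i + j = n then a j else 0)"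
    by auto
  finally show ?thesis .
qed

lemma form_of_in_binary_forms: "form_of n a \<in> binary_forms n"
  by (simp add: binary_forms_def coeff_form_of)

lemma form_of_coeffs:
  assumes "f \<in> binary_forms n"
  shows "form_of n (\<lambda>j. coeff (coeff f j) (n - j)) = f"
proof (intro poly_eqI)
  fix i j
  show "coeff (coeff (form_of n (\<lambda>j. coeff (coeff f j) (n - j))) j) i = coeff (coeff f j) i"
    using binary_formsD[OF assms, of i j] by (auto simp: coeff_form_of)
qed

lemma sums_of_powers_subset: "sums_of_powers k d s \<subseteq> binary_forms (k * d)"
  unfolding sums_of_powers_def
  by (auto intro!: sum_in_binary_forms power_in_binary_forms)

text \<open>
  A closed set is cut out by polynomials and contains \<open>S\<close> iff each of them vanishes on \<open>S\<close>. This
  reduces density to statements about one polynomial at a time.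
\<close>

lemma zariski_dense_iff:
  assumes S: "S \<subseteq> binary_forms n"
  shows "zariski_dense n S \<longleftrightarrow>
    (\<forall>P\<in>coeff_polynomials. (\<forall>f\<in>S. P f = 0) \<longrightarrow> (\<forall>f\<in>binary_forms n. P f = 0))"
proof
  assume dense: "zariski_dense n S"
  show "\<forall>P\<in>coeff_polynomials. (\<forall>f\<in>S. P f = 0) \<longrightarrow> (\<forall>f\<in>binary_forms n. P f = 0)"
  proof (intro ballI impI)
    fix P f
    assume P: "P \<in> coeff_polynomials" "\<forall>f\<in>S. P f = 0" and f: "f \<in> binary_forms n"
    define Z where "Z = {f \<in> binary_forms n. \<forall>P\<in>{P}. P f = 0}"
    have "closedin (zariski_topology n) Z"
      unfolding closedin_zariski zariski_closed_def Z_def using P(1) by (intro exI[of _ "{P}"]) auto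
    moreover have "S \<subseteq> Z" using S P(2) by (auto simp: Z_def)
    ultimately have "binary_forms n \<subseteq> Z"
      using dense closure_of_minimal unfolding zariski_dense_def by metis
    with f show "P f = 0" by (auto simp: Z_def)
  qed
next
  assume R: "\<forall>P\<in>coeff_polynomials. (\<forall>f\<in>S. P f = 0) \<longrightarrow> (\<forall>f\<in>binary_forms n. P f = 0)"
  have "binary_forms n \<subseteq> Z" if Z: "closedin (zariski_topology n) Z" "S \<subseteq> Z" for Z
  proof -
    obtain \<P> where "\<P> \<subseteq> coeff_polynomials" "Z = {f \<in> binary_forms n. \<forall>P\<in>\<P>. P f = 0}"
      using Z(1) unfolding closedin_zariski zariski_closed_def by blast
    with R Z(2) show ?thesis by blast
  qed
  from this[OF closedin_closure_of closure_of_subset]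
  have "zariski_topology n closure_of S = binary_forms n"
    using S closure_of_subset_topspace[of "zariski_topology n" S] by (auto simp: topspace_zariski)
  with S show "zariski_dense n S" by (simp add: zariski_dense_def)
qed

lemma coeff_polynomials_sum:
  "(\<And>a. a \<in> A \<Longrightarrow> P a \<in> coeff_polynomials) \<Longrightarrow> (\<lambda>f. \<Sum>a\<in>A. P a f) \<in> coeff_polynomials"
  by (induction A rule: infinite_finite_induct)
     (auto intro: coeff_polynomials.const coeff_polynomials.add)

lemma coeff_polynomials_prod:
  "(\<And>a. a \<in> A \<Longrightarrow> P a \<in> coeff_polynomials) \<Longrightarrow> (\<lambda>f. \<Prod>a\<in>A. P a f) \<in> coeff_polynomials"
  by (induction A rule: infinite_finite_induct)
     (auto intro: coeff_polynomials.const coeff_polynomials.mult)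

lemma coeff_polynomials_power:
  "P \<in> coeff_polynomials \<Longrightarrow> (\<lambda>f. P f ^ m) \<in> coeff_polynomials"
  using coeff_polynomials_prod[of "{..<m}" "\<lambda>_. P"] by simp

section \<open>Too few parameters: an algebraic relation\<close>

text \<open>
  Gaussian elimination: if some unknown \<open>p\<close> occurs in the equation \<open>b\<close>, solve \<open>b\<close> for it and
  substitute into the other equations; this removes one equation and one unknown.
\<close>

lemma homogeneous_system_nontrivial_solution:
  fixes c :: "'b \<Rightarrow> 'a \<Rightarrow> 'f::field"
  assumes "finite B" "finite A" "card B < card A"
  shows "\<exists>x. (\<exists>a\<in>A. x a \<noteq> 0) \<and> (\<forall>b\<in>B. (\<Sum>a\<in>A. x a * c b a) = 0)"
  using assms
proof (induction B arbitrary: A c rule: finite_induct)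
  case empty
  then have "A \<noteq> {}" by auto
  then show ?case by (intro exI[of _ "\<lambda>_. 1"]) auto
next
  case (insert b B)
  show ?case
  proof (cases "\<exists>p\<in>A. c b p \<noteq> 0")
    case False
    have "card B < card A" using insert.hyps insert.prems by simp
    from insert.IH[OF insert.prems(1) this, of c] False show ?thesis by auto
  next
    case True
    then obtain p where p: "p \<in> A" "c b p \<noteq> 0" by blast
    let ?A = "A - {p}"
    have "card B < card ?A" using insert.hyps insert.prems p(1) by simp
    with insert.IH[of ?A "\<lambda>b' a. c b' a - c b a / c b p * c b' p"] insert.prems(1)
    obtain x where x: "\<exists>a\<in>?A. x a \<noteq> 0"
        "\<forall>b'\<in>B. (\<Sum>a\<in>?A. x a * (c b' a - c b a / c b p * c b' p)) = 0"
      by auto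
    \<comment> \<open>The value of the eliminated unknown that makes equation \<open>b\<close> hold.\<close>
    define xp where "xp = - (\<Sum>a\<in>?A. x a * c b a) / c b p"
    define y where "y = x(p := xp)"
    have sum_y: "(\<Sum>a\<in>A. y a * e a) = xp * e p + (\<Sum>a\<in>?A. x a * e a)" for e
    proof -
      have "(\<Sum>a\<in>A. y a * e a) = y p * e p + (\<Sum>a\<in>?A. y a * e a)"
        using insert.prems(1) p(1) by (rule sum.remove)
      also have "(\<Sum>a\<in>?A. y a * e a) = (\<Sum>a\<in>?A. x a * e a)"
        by (intro sum.cong) (auto simp: y_def)
      finally show ?thesis by (simp add: y_def)
    qed
    have "(\<Sum>a\<in>A. y a * c b a) = 0"
      unfolding sum_y using p(2) by (simp add: xp_def)
    moreover have "(\<Sum>a\<in>A. y a * c b' a) = 0" if "b' \<in> B" for b'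
    proof -
      have "0 = (\<Sum>a\<in>?A. x a * (c b' a - c b a / c b p * c b' p))"
        using x(2) that by simp
      also have "\<dots> = (\<Sum>a\<in>?A. x a * c b' a - x a * c b a * (c b' p / c b p))"
        by (intro sum.cong) (simp_all add: right_diff_distrib)
      also have "\<dots> = (\<Sum>a\<in>?A. x a * c b' a) - (\<Sum>a\<in>?A. x a * c b a) * (c b' p / c b p)"
        by (simp only: sum_subtractf sum_distrib_right)
      finally have "(\<Sum>a\<in>?A. x a * c b' a) = (\<Sum>a\<in>?A. x a * c b a) * (c b' p / c b p)"
        by simp
      then show ?thesis unfolding sum_y by (simp add: xp_def)
    qed
    moreover have "\<exists>a\<in>A. y a \<noteq> 0" using x(1) by (auto simp: y_def)
    ultimately show ?thesis by blast
  qed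
qed

text \<open>
  This is used for one variable of a polynomial in several variables, with the values of the
  others fixed. Bounds on the degree in each variable separately are all that is needed of
  polynomials in several variables, which can so be treated as plain functions.
\<close>

definition poly_fun_le :: "nat \<Rightarrow> (complex \<Rightarrow> complex) \<Rightarrow> bool" where
  "poly_fun_le m \<phi> \<longleftrightarrow> (\<exists>q. degree q \<le> m \<and> (\<forall>t. \<phi> t = poly q t))"

lemma poly_fun_le_mono: "poly_fun_le m \<phi> \<Longrightarrow> m \<le> m' \<Longrightarrow> poly_fun_le m' \<phi>"
  unfolding poly_fun_le_def by (meson order_trans)

lemma poly_fun_le_const: "poly_fun_le m (\<lambda>t. c)"
  unfolding poly_fun_le_def by (rule exI[of _ "[:c:]"]) simp

lemma poly_fun_le_id: "poly_fun_le 1 (\<lambda>t. t)"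
  unfolding poly_fun_le_def by (rule exI[of _ "[:0, 1:]"]) simp

lemma poly_fun_le_mult:
  "poly_fun_le m \<phi> \<Longrightarrow> poly_fun_le m' \<psi> \<Longrightarrow> poly_fun_le (m + m') (\<lambda>t. \<phi> t * \<psi> t)"
  unfolding poly_fun_le_def by (metis add_mono degree_mult_le order_trans poly_mult)

lemma poly_fun_le_sum:
  assumes "\<And>a. a \<in> A \<Longrightarrow> poly_fun_le m (\<phi> a)"
  shows "poly_fun_le m (\<lambda>t. \<Sum>a\<in>A. \<phi> a t)"
proof -
  obtain q where q: "degree (q a) \<le> m" "\<phi> a t = poly (q a) t" if "a \<in> A" for a t
    using assms unfolding poly_fun_le_def by metis
  have "degree (\<Sum>a\<in>A. q a) \<le> m"
    by (cases "finite A") (auto intro: degree_sum_le q(1))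
  moreover have "(\<Sum>a\<in>A. \<phi> a t) = poly (\<Sum>a\<in>A. q a) t" for t
    using q(2) by (simp add: poly_sum)
  ultimately show ?thesis unfolding poly_fun_le_def by blast
qed

lemma poly_fun_le_prod:
  "(\<And>a. a \<in> A \<Longrightarrow> poly_fun_le (m a) (\<phi> a)) \<Longrightarrow> poly_fun_le (\<Sum>a\<in>A. m a) (\<lambda>t. \<Prod>a\<in>A. \<phi> a t)"
  by (induction A rule: infinite_finite_induct)
     (auto intro: poly_fun_le_const poly_fun_le_mult)

lemma poly_fun_le_power: "poly_fun_le m \<phi> \<Longrightarrow> poly_fun_le (r * m) (\<lambda>t. \<phi> t ^ r)"
  using poly_fun_le_prod[of "{..<r}" "\<lambda>_. m" "\<lambda>_. \<phi>"] by simp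

lemma poly_fun_le_eq_0:
  assumes "poly_fun_le m \<phi>" "m < card T" "\<And>t. t \<in> T \<Longrightarrow> \<phi> t = 0"
  shows "\<phi> t = 0"
proof -
  obtain q where q: "degree q \<le> m" "\<And>t. \<phi> t = poly q t"
    using assms(1) unfolding poly_fun_le_def by blast
  have "q = 0"
  proof (rule ccontr)
    assume "q \<noteq> 0"
    then have "finite {t. poly q t = 0}" by (rule poly_roots_finite)
    moreover have "T \<subseteq> {t. poly q t = 0}" using assms(3) q(2) by auto
    ultimately have "card T \<le> card {t. poly q t = 0}" by (rule card_mono)
    also have "\<dots> \<le> degree q" using \<open>q \<noteq> 0\<close> by (rule card_poly_roots_bound)
    finally show False using q(1) assms(2) by simp
  qed
  then show ?thesis using q(2) by simp
qed

text \<open>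
  A polynomial of degree at most \<open>m\<close> in each variable is determined by its values on a grid with
  more than \<open>m\<close> points in each direction: the variables are freed from the grid one by one, and
  the set \<open>J\<close> in the induction holds those that are free already.
\<close>

lemma vanishes_if_vanishes_on_grid:
  fixes \<Phi> :: "('v \<Rightarrow> complex) \<Rightarrow> complex"
  assumes "finite I"
    and deg: "\<And>a p. p \<in> I \<Longrightarrow> poly_fun_le m (\<lambda>t. \<Phi> (a(p := t)))"
    and grid: "\<And>a. a \<in> I \<rightarrow>\<^sub>E T \<Longrightarrow> \<Phi> a = 0" and T: "m < card T"
    and a: "a \<in> extensional I"
  shows "\<Phi> a = 0"
proof -
  have "\<forall>a\<in>extensional I. (\<forall>p\<in>I - J. a p \<in> T) \<longrightarrow> \<Phi> a = 0" if "finite J" "J \<subseteq> I" for J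
    using that
  proof (induction J rule: finite_induct)
    case empty
    then show ?case using grid by (auto simp: PiE_def)
  next
    case (insert p J)
    show ?case
    proof (intro ballI impI)
      fix a
      assume a: "a \<in> extensional I" "\<forall>q\<in>I - insert p J. a q \<in> T"
      have p: "p \<in> I" using insert.prems by simp
      have "\<Phi> (a(p := t)) = 0" if "t \<in> T" for t
        using insert.IH insert.prems a p that by (auto simp: extensional_def)
      from poly_fun_le_eq_0[OF deg[OF p, of a] T this, of "a p"] show "\<Phi> a = 0" by simp
    qed
  qed
  from this[OF \<open>finite I\<close> subset_refl] a show ?thesis by simp
qed

text \<open>
  Counting. The exponent vectors \<open>\<alpha>\<close> with entries below \<open>D\<close> give \<open>D\<close> to the power \<open>card J\<close>
  monomials in the \<open>F j\<close>, and their degree in each variable is at most \<open>m = card J * k * D\<close>. A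
  linear combination of them vanishes as soon as it vanishes on a grid with \<open>m + 1\<close> points in each
  direction, which is a linear condition for each of the \<open>m + 1\<close> to the power \<open>card I\<close> grid
  points. For large \<open>D\<close> there are more monomials than conditions because \<open>card J > card I\<close>.
\<close>

lemma algebraically_dependent:
  fixes F :: "'c \<Rightarrow> ('v \<Rightarrow> complex) \<Rightarrow> complex"
  assumes fin: "finite I" "finite J" and less: "card I < card J"
    and deg: "\<And>j a p. j \<in> J \<Longrightarrow> p \<in> I \<Longrightarrow> poly_fun_le k (\<lambda>t. F j (a(p := t)))"
  shows "\<exists>D x. (\<exists>\<alpha>\<in>J \<rightarrow>\<^sub>E {..<D}. x \<alpha> \<noteq> 0) \<and>
    (\<forall>a\<in>extensional I. (\<Sum>\<alpha>\<in>J \<rightarrow>\<^sub>E {..<D}. x \<alpha> * (\<Prod>j\<in>J. F j a ^ \<alpha> j)) = 0)"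
proof -
  \<comment> \<open>The grid has at most \<open>(C * D) ^ card I\<close> points; with \<open>D > C ^ card I\<close> this is less than
    \<open>D ^ Suc (card I)\<close>.\<close>
  define C where "C = card J * k + 1"
  define D where "D = C ^ card I + 1"
  define m where "m = card J * k * D"
  define A where "A = (J \<rightarrow>\<^sub>E {..<D})"
  define T where "T = (of_nat :: nat \<Rightarrow> complex) ` {..m}"
  have card_T: "card T = m + 1"
    unfolding T_def by (subst card_image) (auto simp: inj_on_def)
  have D: "D > 0" by (simp add: D_def)
  have "card (I \<rightarrow>\<^sub>E T) = (m + 1) ^ card I"
    using fin(1) by (simp add: card_funcsetE card_T)
  also have "\<dots> \<le> (C * D) ^ card I"
    using D by (intro power_mono) (auto simp: m_def C_def algebra_simps)
  also have "\<dots> < D ^ Suc (card I)"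
    using D by (simp add: power_mult_distrib) (simp add: D_def)
  also have "\<dots> \<le> D ^ card J"
    using less D by (intro power_increasing) auto
  also have "\<dots> = card A"
    using fin(2) by (simp add: A_def card_funcsetE)
  finally have "card (I \<rightarrow>\<^sub>E T) < card A" .
  moreover have "finite A" "finite (I \<rightarrow>\<^sub>E T)"
    using fin by (auto simp: A_def T_def intro!: finite_PiE)
  ultimately obtain x where x: "\<exists>\<alpha>\<in>A. x \<alpha> \<noteq> 0"
      "\<forall>a\<in>I \<rightarrow>\<^sub>E T. (\<Sum>\<alpha>\<in>A. x \<alpha> * (\<Prod>j\<in>J. F j a ^ \<alpha> j)) = 0"
    using homogeneous_system_nontrivial_solution
      [of "I \<rightarrow>\<^sub>E T" A "\<lambda>a \<alpha>. \<Prod>j\<in>J. F j a ^ \<alpha> j"] by blast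
  have mono: "poly_fun_le m (\<lambda>t. x \<alpha> * (\<Prod>j\<in>J. F j (a(p := t)) ^ \<alpha> j))"
    if "\<alpha> \<in> A" "p \<in> I" for \<alpha> a p
  proof -
    have "poly_fun_le (0 + (\<Sum>j\<in>J. \<alpha> j * k)) (\<lambda>t. x \<alpha> * (\<Prod>j\<in>J. F j (a(p := t)) ^ \<alpha> j))"
      using deg that(2)
      by (intro poly_fun_le_mult poly_fun_le_const poly_fun_le_prod poly_fun_le_power) auto
    moreover have "(\<Sum>j\<in>J. \<alpha> j * k) \<le> (\<Sum>j\<in>J. D * k)"
      using that(1) by (intro sum_mono mult_right_mono) (auto simp: A_def PiE_def Pi_def less_imp_le)
    ultimately show ?thesis
      by (rule_tac poly_fun_le_mono) (auto simp: m_def mult_ac)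
  qed
  have "(\<Sum>\<alpha>\<in>A. x \<alpha> * (\<Prod>j\<in>J. F j a ^ \<alpha> j)) = 0" if "a \<in> extensional I" for a
  proof (rule vanishes_if_vanishes_on_grid[OF fin(1), where m = m and T = T
          and \<Phi> = "\<lambda>a. \<Sum>\<alpha>\<in>A. x \<alpha> * (\<Prod>j\<in>J. F j a ^ \<alpha> j)"])
    show "poly_fun_le m (\<lambda>t. \<Sum>\<alpha>\<in>A. x \<alpha> * (\<Prod>j\<in>J. F j (a(p := t)) ^ \<alpha> j))"
      if "p \<in> I" for a p
      by (rule poly_fun_le_sum) (rule mono[OF _ that])
  qed (use x(2) card_T that in auto)
  with x(1) show ?thesis unfolding A_def by blast
qed

lemma base_expansion_less:
  fixes \<alpha> :: "nat \<Rightarrow> nat"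
  assumes "\<forall>j<N. \<alpha> j < D"
  shows "(\<Sum>j<N. \<alpha> j * D ^ j) < D ^ N"
  using assms
proof (induction N)
  case (Suc N)
  then have "(\<Sum>j<Suc N. \<alpha> j * D ^ j) < D ^ N + \<alpha> N * D ^ N" by simp
  also have "\<dots> = Suc (\<alpha> N) * D ^ N" by simp
  also have "\<dots> \<le> D * D ^ N" using Suc.prems by (intro mult_right_mono) auto
  finally show ?case by simp
qed simp

lemma base_expansion_inj:
  fixes \<alpha> \<beta> :: "nat \<Rightarrow> nat"
  assumes "\<forall>j<N. \<alpha> j < D" "\<forall>j<N. \<beta> j < D"
    and "(\<Sum>j<N. \<alpha> j * D ^ j) = (\<Sum>j<N. \<beta> j * D ^ j)"
  shows "\<forall>j<N. \<alpha> j = \<beta> j"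
  using assms
proof (induction N)
  case (Suc N)
  have digits: "((\<Sum>j<Suc N. \<gamma> j * D ^ j) mod D ^ N = (\<Sum>j<N. \<gamma> j * D ^ j)) \<and>
      ((\<Sum>j<Suc N. \<gamma> j * D ^ j) div D ^ N = \<gamma> N)" if "\<forall>j<Suc N. \<gamma> j < D" for \<gamma>
    using base_expansion_less[of N \<gamma> D] that by auto
  have "\<alpha> N = \<beta> N" "(\<Sum>j<N. \<alpha> j * D ^ j) = (\<Sum>j<N. \<beta> j * D ^ j)"
    using digits[OF Suc.prems(1)] digits[OF Suc.prems(2)] Suc.prems(3) by metis+
  with Suc.IH Suc.prems show ?case by (auto simp: less_Suc_eq)
qed simp

text \<open>
  Kronecker substitution: putting \<open>t\<close> to the power \<open>D ^ j\<close> for the \<open>j\<close>-th variable turns the monomial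
  with exponents \<open>\<alpha>\<close> into the power of \<open>t\<close> whose exponent has the base-\<open>D\<close> digits \<open>\<alpha>\<close>. Distinct
  monomials stay distinct, so the result is a nonzero polynomial in \<open>t\<close>.
\<close>

lemma reduced_polynomial_nonzero_somewhere:
  fixes x :: "(nat \<Rightarrow> nat) \<Rightarrow> complex"
  assumes "\<alpha> \<in> {..<N} \<rightarrow>\<^sub>E {..<D}" "x \<alpha> \<noteq> 0"
  shows "\<exists>v. (\<Sum>\<alpha>\<in>{..<N} \<rightarrow>\<^sub>E {..<D}. x \<alpha> * (\<Prod>j<N. v j ^ \<alpha> j)) \<noteq> 0"
proof -
  let ?A = "{..<N} \<rightarrow>\<^sub>E {..<D}"
  define e where "e = (\<lambda>\<alpha>. \<Sum>j<N. \<alpha> j * D ^ j)"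
  define p where "p = (\<Sum>\<alpha>\<in>?A. monom (x \<alpha>) (e \<alpha>))"
  have e_inj: "\<beta> = \<alpha>" if "\<beta> \<in> ?A" "e \<beta> = e \<alpha>" for \<beta>
  proof -
    have "\<forall>j<N. \<beta> j = \<alpha> j"
      using that assms(1) by (intro base_expansion_inj[of N \<beta> D \<alpha>]) (auto simp: e_def PiE_iff)
    then show ?thesis using PiE_ext[OF that(1) assms(1)] by auto
  qed
  have "coeff p (e \<alpha>) = (\<Sum>\<beta>\<in>?A. if \<beta> = \<alpha> then x \<beta> else 0)"
    unfolding p_def coeff_sum by (intro sum.cong) (auto dest: e_inj)
  also have "\<dots> = x \<alpha>"
    using assms(1) by (simp add: finite_PiE)
  finally have "p \<noteq> 0" using assms(2) by auto
  then obtain t where t: "poly p t \<noteq> 0" using poly_all_0_iff_0 by blast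
  have "poly p t = (\<Sum>\<alpha>\<in>?A. x \<alpha> * (\<Prod>j<N. (t ^ (D ^ j)) ^ \<alpha> j))"
    by (simp add: p_def poly_sum poly_monom e_def power_sum mult.commute flip: power_mult)
  with t show ?thesis by (intro exI[of _ "\<lambda>j. t ^ (D ^ j)"]) simp
qed

lemma poly_fun_le_coeff_power:
  assumes "\<And>i j. poly_fun_le m (\<lambda>t. coeff (coeff (H t) j) i)"
  shows "poly_fun_le (k * m) (\<lambda>t. coeff (coeff (H t ^ k) j) i)"
proof (induction k arbitrary: i j)
  case 0
  show ?case by (simp add: poly_fun_le_const)
next
  case (Suc k)
  have "poly_fun_le (m + k * m) (\<lambda>t. coeff (coeff (H t * H t ^ k) j) i)"
    unfolding coeff_coeff_mult by (intro poly_fun_le_sum poly_fun_le_mult assms Suc.IH)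
  then show ?case by simp
qed

text \<open>
  The parameter indexed by \<open>(i, j)\<close> is the coefficient of \<open>y\<^sup>j\<close> in the \<open>i\<close>-th form, and \<open>F j\<close> is
  the coefficient of \<open>y\<^sup>j\<close> in the sum of the \<open>k\<close>-th powers. The relation between the \<open>F j\<close> is the
  polynomial \<open>P\<close>.
\<close>

lemma sums_of_powers_not_dense:
  assumes "s * (d + 1) < k * d + 1"
  shows "\<not> zariski_dense (k * d) (sums_of_powers k d s)"
proof
  define n where "n = k * d"
  define I where "I = {..<s} \<times> {..d}"
  define g where "g = (\<lambda>(a :: nat \<times> nat \<Rightarrow> complex) i. form_of d (\<lambda>j. a (i, j)))"
  define F where "F = (\<lambda>j a. coeff (coeff (\<Sum>i<s. g a i ^ k) j) (n - j))"
  have "poly_fun_le 1 (\<lambda>t. coeff (coeff (g (a(p := t)) i) j') i')" for a p i i' j'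
    using poly_fun_le_id poly_fun_le_const
    by (cases "p = (i, j')"; cases "i' + j' = d") (simp_all add: g_def coeff_form_of)
  from poly_fun_le_coeff_power[OF this, of k]
  have deg: "poly_fun_le k (\<lambda>t. F j (a(p := t)))" for j a p
    unfolding F_def coeff_sum by (intro poly_fun_le_sum) simp
  have "card I < card {..<n + 1}" using assms by (simp add: I_def n_def)
  with algebraically_dependent[of I "{..<n + 1}" k F] deg
  obtain D x where x: "\<exists>\<alpha>\<in>{..<n + 1} \<rightarrow>\<^sub>E {..<D}. x \<alpha> \<noteq> 0"
      "\<forall>a\<in>extensional I. (\<Sum>\<alpha>\<in>{..<n + 1} \<rightarrow>\<^sub>E {..<D}. x \<alpha> * (\<Prod>j<n + 1. F j a ^ \<alpha> j)) = 0"
    by (auto simp: I_def)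
  define P where
    "P = (\<lambda>f. \<Sum>\<alpha>\<in>{..<n + 1} \<rightarrow>\<^sub>E {..<D}. x \<alpha> * (\<Prod>j<n + 1. coeff (coeff f j) (n - j) ^ \<alpha> j))"
  assume "zariski_dense (k * d) (sums_of_powers k d s)"
  moreover have "P \<in> coeff_polynomials"
    unfolding P_def
    by (intro coeff_polynomials_sum coeff_polynomials.mult coeff_polynomials.const
          coeff_polynomials_prod coeff_polynomials_power coeff_polynomials.coordinate)
  moreover have "P f = 0" if f: "f \<in> sums_of_powers k d s" for f
  proof -
    obtain h where h: "\<forall>i<s. h i \<in> binary_forms d" "f = (\<Sum>i<s. h i ^ k)"
      using f unfolding sums_of_powers_def by blast
    define a where "a = restrict (\<lambda>(i, j). coeff (coeff (h i) j) (d - j)) I"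
    have "g a i = h i" if "i < s" for i
    proof -
      have "g a i = form_of d (\<lambda>j. coeff (coeff (h i) j) (d - j))"
        using that by (auto simp: g_def form_of_def a_def I_def intro!: sum.cong)
      with h(1) that show ?thesis by (simp add: form_of_coeffs)
    qed
    then have F: "F j a = coeff (coeff f j) (n - j)" for j
      by (simp add: F_def h(2))
    have "a \<in> extensional I" by (simp add: a_def)
    from bspec[OF x(2) this] show ?thesis by (simp only: P_def F)
  qed
  ultimately have zero: "P f = 0" if "f \<in> binary_forms n" for f
    using zariski_dense_iff[OF sums_of_powers_subset, of k d s] that unfolding n_def by blast
  obtain v where "(\<Sum>\<alpha>\<in>{..<n + 1} \<rightarrow>\<^sub>E {..<D}. x \<alpha> * (\<Prod>j<n + 1. v j ^ \<alpha> j)) \<noteq> 0"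
    using x(1) reduced_polynomial_nonzero_somewhere by blast
  moreover have "P (form_of n v) =
      (\<Sum>\<alpha>\<in>{..<n + 1} \<rightarrow>\<^sub>E {..<D}. x \<alpha> * (\<Prod>j<n + 1. v j ^ \<alpha> j))"
    unfolding P_def by (intro sum.cong prod.cong arg_cong2[where f = "(*)"])
      (auto simp: coeff_form_of)
  ultimately show False using zero[OF form_of_in_binary_forms, of v] by simp
qed

section \<open>The span of the osculating spaces of the rational normal curve\<close>

definition X_form :: "complex poly poly" where
  "X_form = [:[:0, 1:]:]"

text \<open>
  The linear form \<open>y + c x\<close>.
\<close>

definition line_form :: "complex \<Rightarrow> complex poly poly" where
  "line_form c = [:[:0, c:], 1:]"

lemma X_form_in_binary_forms: "X_form \<in> binary_forms 1"
  by (auto simp: binary_forms_def X_form_def coeff_pCons split: nat.splits)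

lemma line_form_in_binary_forms: "line_form c \<in> binary_forms 1"
  by (auto simp: binary_forms_def line_form_def coeff_pCons split: nat.splits)

lemma line_form_add: "line_form (c + t) = line_form c + smult [:t:] X_form"
  by (simp add: line_form_def X_form_def)

lemma X_power_line_power_in_binary_forms:
  "m \<le> n \<Longrightarrow> X_form ^ m * line_form c ^ (n - m) \<in> binary_forms n"
  using mult_in_binary_forms[OF power_in_binary_forms[OF X_form_in_binary_forms, of m]
      power_in_binary_forms[OF line_form_in_binary_forms, of c "n - m"]]
  by simp

lemma form_of_conv_monomials:
  "form_of n a = (\<Sum>j\<le>n. smult [:a j:] (X_form ^ (n - j) * line_form 0 ^ j))"
proof -
  have "monom (monom c i) j = smult [:c:] (X_form ^ i * line_form 0 ^ j)" for c i j
  proof -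
    have "X_form ^ i = [:monom 1 i:]"
      by (induction i) (simp_all add: X_form_def one_pCons monom_Suc)
    moreover have "line_form 0 ^ j = monom 1 j"
      by (simp add: line_form_def monom_altdef)
    ultimately show ?thesis by (simp add: smult_monom)
  qed
  then show ?thesis by (simp add: form_of_def)
qed

lemma vector_space_smult_const: "vector_space (\<lambda>c. smult [:c:] :: complex poly poly \<Rightarrow> complex poly poly)"
proof
  fix a b :: complex and p :: "complex poly poly"
  show "smult [:a + b:] p = smult [:a:] p + smult [:b:] p"
    by (simp flip: smult_add_left)
  show "smult [:a:] (smult [:b:] p) = smult [:a * b:] p"
    by (simp add: mult.commute)
qed (simp_all add: smult_add_right flip: one_pCons)

lemma smult_sum_right: "smult c (\<Sum>i\<in>A. f i) = (\<Sum>i\<in>A. smult c (f i))"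
  by (induction A rule: infinite_finite_induct) (simp_all add: smult_add_right)

text \<open>
  Extend a basis \<open>B\<close> of \<open>W\<close> by \<open>u\<close> and prescribe the values \<open>0\<close> on \<open>B\<close> and \<open>1\<close> at \<open>u\<close>.
\<close>

lemma separating_functional:
  assumes vs: "vector_space s1" and W: "module.subspace s1 W" and u: "u \<notin> W"
  shows "\<exists>\<phi>. Vector_Spaces.linear s1 (*) \<phi> \<and> (\<forall>w\<in>W. \<phi> w = 0) \<and> \<phi> u \<noteq> (0 :: 'k::field)"
proof -
  interpret vector_space s1 by fact
  interpret K: vector_space "(*) :: 'k \<Rightarrow> 'k \<Rightarrow> 'k"
    by unfold_locales (simp_all add: algebra_simps)
  interpret pair: vector_space_pair s1 "(*) :: 'k \<Rightarrow> 'k \<Rightarrow> 'k" ..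
  obtain B where B: "B \<subseteq> W" "independent B" "W \<subseteq> span B"
    using maximal_independent_subset .
  have u': "u \<notin> span B" using span_minimal[OF B(1) W] u by blast
  then have "independent (insert u B)" using B(2) by (rule independent_insertI)
  from pair.linear_independent_extend[OF this, of "\<lambda>b. if b = u then 1 else 0"]
  obtain \<phi> where \<phi>: "Vector_Spaces.linear s1 (*) \<phi>"
      "\<forall>b\<in>insert u B. \<phi> b = (if b = u then 1 else 0)" by blast
  have "u \<notin> B" using u' span_base by blast
  then have "\<phi> b = 0" if "b \<in> B" for b using \<phi>(2) that by auto
  then have "\<phi> w = 0" if "w \<in> W" for w
    using pair.linear_eq_0_on_span[OF \<phi>(1)] B(3) that by blast
  with \<phi> show ?thesis by auto
qed

lemma binomial_smult:
  fixes g h :: "complex poly poly"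
  shows "(g + smult [:\<epsilon>:] h) ^ k =
    (\<Sum>m\<le>k. smult [:of_nat (k choose m) * \<epsilon> ^ m:] (h ^ m * g ^ (k - m)))"
proof -
  have const: "[:\<epsilon>:] ^ m = [:\<epsilon> ^ m:]" for m
    by (induction m) (simp_all add: one_pCons)
  have "(g + smult [:\<epsilon>:] h) ^ k = (\<Sum>m\<le>k. of_nat (k choose m) * (smult [:\<epsilon>:] h) ^ m * g ^ (k - m))"
    by (subst add.commute) (rule binomial_ring)
  also have "\<dots> = (\<Sum>m\<le>k. smult [:of_nat (k choose m) * \<epsilon> ^ m:] (h ^ m * g ^ (k - m)))"
    by (intro sum.cong refl) (simp add: smult_power const of_nat_poly mult_ac)
  finally show ?thesis .
qed

text \<open>
  The polynomial \<open>G b\<close> is \<open>t \<mapsto> \<phi> ((y + (b + t) x)\<^sup>n)\<close>. By the binomial theorem the coefficient of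
  \<open>t\<^sup>m\<close> in it is, up to a binomial coefficient, the value of \<open>\<phi>\<close> at \<open>x\<^sup>m (y + b x)\<^sup>n\<^sup>-\<^sup>m\<close>. For
  \<open>b \<in> T\<close> the coefficients up to \<open>t\<^sup>d\<close> vanish, so \<open>G 0\<close> has a zero of order \<open>d + 1\<close> at each
  point of \<open>T\<close>, which is too much for its degree. The coefficients of \<open>G 0 = 0\<close> then give the
  values of \<open>\<phi>\<close> on the monomials.
\<close>

lemma functional_zero_if_zero_on_osculating_spaces:
  assumes \<phi>: "Vector_Spaces.linear (\<lambda>c. smult [:c:]) (*) \<phi>"
    and n: "n < card T * (d + 1)"
    and kills: "\<And>c m. c \<in> T \<Longrightarrow> m \<le> d \<Longrightarrow> \<phi> (X_form ^ m * line_form c ^ (n - m)) = (0 :: complex)"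
    and f: "f \<in> binary_forms n"
  shows "\<phi> f = 0"
proof -
  interpret Vector_Spaces.linear "\<lambda>c. smult [:c:] :: complex poly poly \<Rightarrow> complex poly poly" "(*)" \<phi>
    by fact
  define G where "G = (\<lambda>b. \<Sum>m\<le>n. monom (of_nat (n choose m) * \<phi> (X_form ^ m * line_form b ^ (n - m))) m)"
  have coeff_G: "coeff (G b) m =
      (if m \<le> n then of_nat (n choose m) * \<phi> (X_form ^ m * line_form b ^ (n - m)) else 0)" for b m
    by (simp add: G_def coeff_sum)
  have poly_G: "poly (G b) t = \<phi> (line_form (b + t) ^ n)" for b t
  proof -
    have "line_form (b + t) ^ n =
        (\<Sum>m\<le>n. smult [:of_nat (n choose m) * t ^ m:] (X_form ^ m * line_form b ^ (n - m)))"
      unfolding line_form_add by (rule binomial_smult)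
    then show ?thesis
      by (simp add: sum scale G_def poly_sum poly_monom mult_ac)
  qed
  have shift: "G 0 = pcompose (G b) [:- b, 1:]" for b
  proof (rule poly_ext)
    fix t
    show "poly (G 0) t = poly (pcompose (G b) [:- b, 1:]) t"
      by (simp add: poly_pcompose poly_G)
  qed
  have dvd: "[:- c, 1:] ^ (d + 1) dvd G 0" if "c \<in> T" for c
  proof -
    have "coeff (G c) m = 0" if "m < d + 1" for m
      using kills[OF \<open>c \<in> T\<close>, of m] that by (simp add: coeff_G)
    then have "monom 1 (d + 1) dvd G c" by (simp add: monom_1_dvd_iff')
    then obtain q where "G c = [:0, 1:] ^ (d + 1) * q" by (auto simp: monom_altdef elim: dvdE)
    then have "G 0 = [:- c, 1:] ^ (d + 1) * pcompose q [:- c, 1:]"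
      by (intro poly_ext) (simp add: shift[of c] poly_pcompose algebra_simps)
    then show ?thesis by simp
  qed
  have G0: "G 0 = 0"
  proof (rule ccontr)
    assume nz: "G 0 \<noteq> 0"
    then have ord: "d + 1 \<le> order c (G 0)" if "c \<in> T" for c
      using dvd[OF that] unfolding order_divides by blast
    have "card T * (d + 1) = (\<Sum>c\<in>T. d + 1)" by simp
    also have "\<dots> \<le> (\<Sum>c\<in>T. order c (G 0))" by (intro sum_mono ord)
    also have "\<dots> \<le> (\<Sum>c | poly (G 0) c = 0. order c (G 0))"
    proof (rule sum_mono2)
      show "T \<subseteq> {c. poly (G 0) c = 0}"
        using ord by (fastforce simp: order_root)
    qed (use nz in \<open>simp_all add: poly_roots_finite\<close>)
    also have "\<dots> \<le> degree (G 0)" using nz by (rule sum_order_le_degree)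
    also have "\<dots> \<le> n" by (rule degree_le) (simp add: coeff_G)
    finally show False using n by simp
  qed
  have mono: "\<phi> (X_form ^ m * line_form 0 ^ (n - m)) = 0" if "m \<le> n" for m
    using coeff_G[of 0 m] that by (simp add: G0)
  have "\<phi> f = \<phi> (\<Sum>j\<le>n. smult [:coeff (coeff f j) (n - j):] (X_form ^ (n - j) * line_form 0 ^ j))"
    using form_of_coeffs[OF f] by (simp add: form_of_conv_monomials)
  also have "\<dots> = 0"
  proof -
    have "\<phi> (X_form ^ (n - j) * line_form 0 ^ j) = 0" if "j \<le> n" for j
      using mono[of "n - j"] that by simp
    then show ?thesis by (simp add: sum scale)
  qed
  finally show ?thesis .
qed

text \<open>
  If \<open>u\<close> were outside the space \<open>W\<close> of all such sums, a functional would separate the two. It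
  vanishes on the products \<open>x\<^sup>m (y + c x)\<^sup>n\<^sup>-\<^sup>m\<close> for \<open>m \<le> d\<close>, since these are multiples of
  \<open>(y + c x)\<^sup>n\<^sup>-\<^sup>d\<close>, and hence on \<open>u\<close>.
\<close>

lemma powers_of_lines_span:
  assumes n: "n < card T * (d + 1)" and fin: "finite T" and dn: "d \<le> n"
    and u: "u \<in> binary_forms n"
  shows "\<exists>h. (\<forall>c\<in>T. h c \<in> binary_forms d) \<and> u = (\<Sum>c\<in>T. h c * line_form c ^ (n - d))"
proof (rule ccontr)
  define W where
    "W = {\<Sum>c\<in>T. h c * line_form c ^ (n - d) | h. \<forall>c\<in>T. h c \<in> binary_forms d}"
  interpret vector_space "\<lambda>c. smult [:c:] :: complex poly poly \<Rightarrow> complex poly poly"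
    by (rule vector_space_smult_const)
  assume "\<not> ?thesis"
  then have "u \<notin> W" by (auto simp: W_def)
  moreover have "subspace W"
    unfolding subspace_def
  proof (intro conjI ballI allI)
    show "0 \<in> W"
      unfolding W_def by (intro CollectI exI[of _ "\<lambda>_. 0"]) (simp add: zero_in_binary_forms)
  next
    fix v w
    assume "v \<in> W" "w \<in> W"
    then obtain h h' where "\<forall>c\<in>T. h c \<in> binary_forms d" "\<forall>c\<in>T. h' c \<in> binary_forms d"
        "v = (\<Sum>c\<in>T. h c * line_form c ^ (n - d))" "w = (\<Sum>c\<in>T. h' c * line_form c ^ (n - d))"
      unfolding W_def by blast
    then show "v + w \<in> W"
      unfolding W_def by (intro CollectI exI[of _ "\<lambda>c. h c + h' c"])
        (simp add: add_in_binary_forms sum.distrib distrib_right)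
  next
    fix e w
    assume "w \<in> W"
    then obtain h where "\<forall>c\<in>T. h c \<in> binary_forms d" "w = (\<Sum>c\<in>T. h c * line_form c ^ (n - d))"
      unfolding W_def by blast
    then show "smult [:e:] w \<in> W"
      unfolding W_def by (intro CollectI exI[of _ "\<lambda>c. smult [:e:] (h c)"])
        (simp add: smult_in_binary_forms smult_sum_right)
  qed
  ultimately obtain \<phi> where \<phi>: "Vector_Spaces.linear (\<lambda>c. smult [:c:]) (*) \<phi>"
      "\<forall>w\<in>W. \<phi> w = 0" "\<phi> u \<noteq> (0 :: complex)"
    using separating_functional[OF vector_space_axioms] by blast
  have "\<phi> (X_form ^ m * line_form c ^ (n - m)) = 0" if "c \<in> T" "m \<le> d" for c m
  proof -
    let ?h = "\<lambda>c'. if c' = c then X_form ^ m * line_form c ^ (d - m) else 0"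
    have "line_form c ^ (n - m) = line_form c ^ (d - m) * line_form c ^ (n - d)"
      using that(2) dn by (simp flip: power_add)
    moreover have "(\<Sum>c'\<in>T. ?h c' * line_form c' ^ (n - d)) =
        (\<Sum>c'\<in>T. if c' = c then X_form ^ m * line_form c ^ (d - m) * line_form c ^ (n - d) else 0)"
      by (intro sum.cong) auto
    ultimately have "X_form ^ m * line_form c ^ (n - m) = (\<Sum>c'\<in>T. ?h c' * line_form c' ^ (n - d))"
      using fin that(1) by (simp add: mult.assoc)
    moreover have "\<forall>c'\<in>T. ?h c' \<in> binary_forms d"
      using X_power_line_power_in_binary_forms[OF that(2), of c] by (simp add: zero_in_binary_forms)
    ultimately have "X_form ^ m * line_form c ^ (n - m) \<in> W"
      unfolding W_def by (intro CollectI exI[of _ ?h] conjI)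
    with \<phi>(2) show ?thesis by blast
  qed
  from functional_zero_if_zero_on_osculating_spaces[OF \<phi>(1) n this u] \<phi>(3) show False by simp
qed

section \<open>Enough parameters: Terracini's argument\<close>

text \<open>
  The coefficient of \<open>\<epsilon>\<^sup>m\<close> in \<open>Q u\<close> is the homogeneous part of degree \<open>m\<close> of \<open>P\<close> at \<open>f\<close>, as a
  function of the direction \<open>u\<close>. It matters that it is again a polynomial function of \<open>u\<close>, hence
  continuous, and that the degree is bounded for all \<open>u\<close> at once.
\<close>

lemma taylor_expansion:
  assumes "P \<in> coeff_polynomials"
  shows "\<exists>Q D. (\<forall>u \<epsilon>. P (f + smult [:\<epsilon>:] u) = poly (Q u) \<epsilon>) \<and>
    (\<forall>m. (\<lambda>u. coeff (Q u) m) \<in> coeff_polynomials) \<and> (\<forall>u. degree (Q u) \<le> D)"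
  using assms
proof induction
  case (const c)
  show ?case
    by (rule exI[of _ "\<lambda>_. [:c:]"], rule exI[of _ 0]) (auto intro: coeff_polynomials.const)
next
  case (coordinate j i)
  have "(\<lambda>u. coeff [:coeff (coeff f j) i, coeff (coeff u j) i:] m) \<in> coeff_polynomials" for m
    by (cases m; cases "m - 1")
       (auto simp: coeff_pCons intro: coeff_polynomials.const coeff_polynomials.coordinate)
  then show ?case
    by (intro exI[of _ "\<lambda>u. [:coeff (coeff f j) i, coeff (coeff u j) i:]"] exI[of _ 1])
       (auto simp: degree_pCons_eq_if)
next
  case (add P P')
  then obtain Q D Q' D' where *:
    "\<And>u \<epsilon>. P (f + smult [:\<epsilon>:] u) = poly (Q u) \<epsilon>"
    "\<And>m. (\<lambda>u. coeff (Q u) m) \<in> coeff_polynomials" "\<And>u. degree (Q u) \<le> D"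
    "\<And>u \<epsilon>. P' (f + smult [:\<epsilon>:] u) = poly (Q' u) \<epsilon>"
    "\<And>m. (\<lambda>u. coeff (Q' u) m) \<in> coeff_polynomials" "\<And>u. degree (Q' u) \<le> D'"
    by metis
  have "degree (Q u + Q' u) \<le> max D D'" for u
    using *(3)[of u] *(6)[of u] by (intro degree_add_le) auto
  with * show ?case
    by (intro exI[of _ "\<lambda>u. Q u + Q' u"] exI[of _ "max D D'"])
       (auto intro: coeff_polynomials.add)
next
  case (mult P P')
  then obtain Q D Q' D' where *:
    "\<And>u \<epsilon>. P (f + smult [:\<epsilon>:] u) = poly (Q u) \<epsilon>"
    "\<And>m. (\<lambda>u. coeff (Q u) m) \<in> coeff_polynomials" "\<And>u. degree (Q u) \<le> D"
    "\<And>u \<epsilon>. P' (f + smult [:\<epsilon>:] u) = poly (Q' u) \<epsilon>"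
    "\<And>m. (\<lambda>u. coeff (Q' u) m) \<in> coeff_polynomials" "\<And>u. degree (Q' u) \<le> D'"
    by metis
  have "degree (Q u * Q' u) \<le> D + D'" for u
    using *(3)[of u] *(6)[of u] degree_mult_le[of "Q u" "Q' u"] by simp
  with * show ?case
    by (intro exI[of _ "\<lambda>u. Q u * Q' u"] exI[of _ "D + D'"])
       (auto simp: coeff_mult intro!: coeff_polynomials_sum coeff_polynomials.mult)
qed

lemma continuous_coeff_polynomial:
  fixes w :: "complex \<Rightarrow> complex poly poly"
  assumes "P \<in> coeff_polynomials" and "\<And>i j. isCont (\<lambda>\<epsilon>. coeff (coeff (w \<epsilon>) j) i) a"
  shows "isCont (\<lambda>\<epsilon>. P (w \<epsilon>)) a"
  using assms(1) by induction (auto intro!: continuous_intros assms(2))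

text \<open>
  From \<open>f0\<close> there starts in each direction \<open>u\<close> a curve \<open>f0 + \<epsilon> w u \<epsilon>\<close> on which \<open>P\<close> vanishes. Let \<open>m\<close>
  be the lowest degree in which the Taylor expansion of \<open>P\<close> at \<open>f0\<close> has a nonzero part. On the
  curve, \<open>P\<close> equals \<open>\<epsilon>\<^sup>m\<close> times a function of \<open>\<epsilon>\<close> that is continuous at \<open>0\<close> and has there the
  degree-\<open>m\<close> part at \<open>u\<close> as its value; so this part vanishes at every \<open>u\<close>, a contradiction.
\<close>

lemma vanishes_if_curves_in_all_directions:
  fixes w :: "complex poly poly \<Rightarrow> complex \<Rightarrow> complex poly poly"
  assumes P: "P \<in> coeff_polynomials"
    and f0: "f0 \<in> binary_forms n"
    and curve: "\<And>u. u \<in> binary_forms n \<Longrightarrow> w u 0 = u"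
    and forms: "\<And>u \<epsilon>. u \<in> binary_forms n \<Longrightarrow> w u \<epsilon> \<in> binary_forms n"
    and cont: "\<And>u i j. u \<in> binary_forms n \<Longrightarrow> isCont (\<lambda>\<epsilon>. coeff (coeff (w u \<epsilon>) j) i) 0"
    and zero: "\<And>u \<epsilon>. u \<in> binary_forms n \<Longrightarrow> P (f0 + smult [:\<epsilon>:] (w u \<epsilon>)) = 0"
    and f: "f \<in> binary_forms n"
  shows "P f = 0"
proof (rule ccontr)
  assume nz: "P f \<noteq> 0"
  obtain Q D where Q: "\<And>u \<epsilon>. P (f0 + smult [:\<epsilon>:] u) = poly (Q u) \<epsilon>"
    "\<And>m. (\<lambda>u. coeff (Q u) m) \<in> coeff_polynomials" "\<And>u. degree (Q u) \<le> D"
    using taylor_expansion[OF P, of f0] by blast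
  define m where "m = (LEAST m. \<exists>u\<in>binary_forms n. coeff (Q u) m \<noteq> 0)"
  have "poly (Q (f - f0)) 1 \<noteq> 0"
    using Q(1)[of 1 "f - f0"] nz by (simp flip: one_pCons)
  then have "\<exists>m. coeff (Q (f - f0)) m \<noteq> 0" by (metis coeff_0 poly_0 poly_eqI)
  moreover have "f - f0 \<in> binary_forms n" using f f0 by (rule diff_in_binary_forms)
  ultimately have "\<exists>m. \<exists>u\<in>binary_forms n. coeff (Q u) m \<noteq> 0" by blast
  then have "\<exists>u\<in>binary_forms n. coeff (Q u) m \<noteq> 0" unfolding m_def by (rule LeastI_ex)
  then obtain u where u: "u \<in> binary_forms n" "coeff (Q u) m \<noteq> 0" by blast
  have low: "coeff (Q v) i = 0" if "v \<in> binary_forms n" "i < m" for v i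
    using not_less_Least that unfolding m_def by blast
  define R where "R = (\<lambda>\<epsilon>. \<Sum>i\<le>D. coeff (Q (w u \<epsilon>)) (m + i) * \<epsilon> ^ i)"
  have R0: "R \<epsilon> = 0" if "\<epsilon> \<noteq> 0" for \<epsilon>
  proof -
    let ?q = "Q (w u \<epsilon>)"
    have "0 = poly ?q \<epsilon>" using Q(1) zero[OF u(1)] by metis
    also have "\<dots> = (\<Sum>i\<le>m + D. coeff ?q i * \<epsilon> ^ i)"
      unfolding poly_altdef using Q(3)[of "w u \<epsilon>"]
      by (intro sum.mono_neutral_left) (auto simp: coeff_eq_0 not_le)
    also have "\<dots> = (\<Sum>i\<in>{m..m + D}. coeff ?q i * \<epsilon> ^ i)"
      using low[OF forms[OF u(1)]] by (intro sum.mono_neutral_right) auto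
    also have "\<dots> = (\<Sum>i\<le>D. coeff ?q (m + i) * \<epsilon> ^ (m + i))"
      by (intro sum.reindex_bij_witness[of _ "\<lambda>i. m + i" "\<lambda>i. i - m"]) auto
    also have "\<dots> = \<epsilon> ^ m * R \<epsilon>"
      by (simp add: R_def sum_distrib_left power_add mult_ac)
    finally show ?thesis using that by simp
  qed
  have "isCont R 0"
    unfolding R_def
    by (intro continuous_intros continuous_coeff_polynomial[OF Q(2)] cont u(1))
  then have "R \<midarrow>0\<rightarrow> R 0" by (simp add: isCont_def)
  moreover have "R \<midarrow>0\<rightarrow> 0"
    by (rule Lim_transform_eventually[OF tendsto_const]) (auto simp: eventually_at_filter R0)
  ultimately have "R 0 = 0" by (rule LIM_unique)
  moreover have "R 0 = (\<Sum>i\<le>D. if i = 0 then coeff (Q u) (m + i) else 0)"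
    unfolding R_def curve[OF u(1)] by (intro sum.cong) auto
  then have "R 0 = coeff (Q u) m" by simp
  ultimately show False using u(2) by simp
qed

text \<open>
  The factor of \<open>\<epsilon>\<close> on the right is the curve of directions used below; its value at \<open>\<epsilon> = 0\<close> is
  the derivative \<open>k h g\<^sup>k\<^sup>-\<^sup>1\<close>.
\<close>

lemma binomial_increment:
  fixes g h :: "complex poly poly"
  shows "(g + smult [:\<epsilon>:] h) ^ k =
    g ^ k + smult [:\<epsilon>:] (\<Sum>m<k. smult [:of_nat (k choose Suc m) * \<epsilon> ^ m:] (h ^ Suc m * g ^ (k - Suc m)))"
proof -
  have "(g + smult [:\<epsilon>:] h) ^ k =
      (\<Sum>m\<le>k. smult [:of_nat (k choose m) * \<epsilon> ^ m:] (h ^ m * g ^ (k - m)))"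
    by (rule binomial_smult)
  also have "\<dots> = g ^ k + (\<Sum>m<k. smult [:of_nat (k choose Suc m) * \<epsilon> ^ Suc m:] (h ^ Suc m * g ^ (k - Suc m)))"
    by (simp add: sum.atMost_shift del: power_Suc binomial_Suc_n flip: one_pCons)
  also have "(\<Sum>m<k. smult [:of_nat (k choose Suc m) * \<epsilon> ^ Suc m:] (h ^ Suc m * g ^ (k - Suc m))) =
     smult [:\<epsilon>:] (\<Sum>m<k. smult [:of_nat (k choose Suc m) * \<epsilon> ^ m:] (h ^ Suc m * g ^ (k - Suc m)))"
    by (simp add: smult_sum_right mult_ac)
  finally show ?thesis .
qed

text \<open>
  The differential at \<open>g\<^sub>i = (y + i x)\<^sup>d\<close> is onto by \<open>powers_of_lines_span\<close>: for each \<open>u\<close> choose a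
  preimage \<open>h u\<close>. The line \<open>g + \<epsilon> h u\<close> in the parameter space is mapped to a curve through \<open>f0\<close>
  in the direction \<open>u\<close>.
\<close>

lemma sums_of_powers_dense:
  assumes k: "k \<ge> 1" and s: "k * d + 1 \<le> s * (d + 1)"
  shows "zariski_dense (k * d) (sums_of_powers k d s)"
  unfolding zariski_dense_iff[OF sums_of_powers_subset]
proof (intro ballI impI)
  define n where "n = k * d"
  define g where "g = (\<lambda>i::nat. line_form (of_nat i) ^ d)"
  define f0 where "f0 = (\<Sum>i<s. g i ^ k)"
  fix P f
  assume P: "P \<in> coeff_polynomials" "\<forall>f\<in>sums_of_powers k d s. P f = 0"
    and f: "f \<in> binary_forms (k * d)"
  have g: "g i \<in> binary_forms d" for i
    using power_in_binary_forms[OF line_form_in_binary_forms, of _ d] by (simp add: g_def)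
  have "\<forall>u\<in>binary_forms n. \<exists>h. (\<forall>i<s. h i \<in> binary_forms d) \<and>
      u = (\<Sum>i<s. smult [:of_nat k:] (h i * g i ^ (k - 1)))"
  proof
    fix u
    assume u: "u \<in> binary_forms n"
    define T where "T = (of_nat :: nat \<Rightarrow> complex) ` {..<s}"
    have inj: "inj_on (of_nat :: nat \<Rightarrow> complex) {..<s}" by (auto simp: inj_on_def)
    have "card T = s" unfolding T_def using inj by (simp add: card_image)
    moreover have "d \<le> n" using k by (simp add: n_def)
    ultimately obtain h where h: "\<forall>c\<in>T. h c \<in> binary_forms d"
        "smult [:1 / of_nat k:] u = (\<Sum>c\<in>T. h c * line_form c ^ (n - d))"
      using powers_of_lines_span[of n T d "smult [:1 / of_nat k:] u"] s smult_in_binary_forms[OF u]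
      by (auto simp: n_def T_def)
    \<comment> \<open>\<open>(y + i x)\<^sup>n\<^sup>-\<^sup>d\<close> is the power \<open>k - 1\<close> of \<open>g i\<close>.\<close>
    have exps: "n - d = d * (k - 1)" by (simp add: n_def algebra_simps diff_mult_distrib)
    have "u = smult [:of_nat k:] (smult [:1 / of_nat k:] u)"
      using k by (simp flip: one_pCons)
    also have "\<dots> = (\<Sum>i<s. smult [:of_nat k:] (h (of_nat i) * g i ^ (k - 1)))"
      unfolding h(2) T_def sum.reindex[OF inj]
      by (simp add: smult_sum_right g_def exps power_mult)
    finally show "\<exists>h. (\<forall>i<s. h i \<in> binary_forms d) \<and>
        u = (\<Sum>i<s. smult [:of_nat k:] (h i * g i ^ (k - 1)))"
      using h(1) by (intro exI[of _ "\<lambda>i. h (of_nat i)"]) (auto simp: T_def)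
  qed
  from bchoice[OF this] obtain h where "\<forall>u\<in>binary_forms n.
      (\<forall>i<s. h u i \<in> binary_forms d) \<and> u = (\<Sum>i<s. smult [:of_nat k:] (h u i * g i ^ (k - 1)))" ..
  then have h: "\<And>u i. u \<in> binary_forms n \<Longrightarrow> i < s \<Longrightarrow> h u i \<in> binary_forms d"
      "\<And>u. u \<in> binary_forms n \<Longrightarrow> (\<Sum>i<s. smult [:of_nat k:] (h u i * g i ^ (k - 1))) = u"
    by auto
  define w where "w = (\<lambda>u \<epsilon>. \<Sum>i<s. \<Sum>m<k.
      smult [:of_nat (k choose Suc m) * \<epsilon> ^ m:] (h u i ^ Suc m * g i ^ (k - Suc m)))"
  have increment: "f0 + smult [:\<epsilon>:] (w u \<epsilon>) = (\<Sum>i<s. (g i + smult [:\<epsilon>:] (h u i)) ^ k)" for u \<epsilon>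
    by (simp add: f0_def w_def binomial_increment smult_sum_right sum.distrib)
  show "P f = 0"
  proof (rule vanishes_if_curves_in_all_directions[OF P(1), of f0 n w])
    show "f0 \<in> binary_forms n"
      unfolding f0_def n_def by (intro sum_in_binary_forms power_in_binary_forms g)
    show "f \<in> binary_forms n" using f by (simp add: n_def)
  next
    fix u
    assume u: "u \<in> binary_forms n"
    have "w u 0 = (\<Sum>i<s. \<Sum>m<k. if m = 0 then smult [:of_nat k:] (h u i * g i ^ (k - 1)) else 0)"
      unfolding w_def by (intro sum.cong) auto
    also have "\<dots> = u" using k h(2)[OF u] by simp
    finally show "w u 0 = u" .
  next
    fix u \<epsilon>
    assume u: "u \<in> binary_forms n"
    show "w u \<epsilon> \<in> binary_forms n"
      unfolding w_def
    proof (intro sum_in_binary_forms smult_in_binary_forms)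
      fix i m
      assume "i \<in> {..<s}" "m \<in> {..<k}"
      then have "h u i ^ Suc m * g i ^ (k - Suc m) \<in> binary_forms (Suc m * d + (k - Suc m) * d)"
        using h(1)[OF u] g by (intro mult_in_binary_forms power_in_binary_forms) auto
      also have "Suc m * d + (k - Suc m) * d = n"
        using \<open>m \<in> {..<k}\<close> unfolding n_def add_mult_distrib[symmetric] by simp
      finally show "h u i ^ Suc m * g i ^ (k - Suc m) \<in> binary_forms n" .
    qed
    show "P (f0 + smult [:\<epsilon>:] (w u \<epsilon>)) = 0"
    proof -
      have "f0 + smult [:\<epsilon>:] (w u \<epsilon>) \<in> sums_of_powers k d s"
        unfolding increment sums_of_powers_def
        using g h(1)[OF u]
        by (intro CollectI exI[of _ "\<lambda>i. g i + smult [:\<epsilon>:] (h u i)"])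
           (simp add: add_in_binary_forms smult_in_binary_forms)
      with P(2) show ?thesis by blast
    qed
  next
    fix u i j
    show "isCont (\<lambda>\<epsilon>. coeff (coeff (w u \<epsilon>) j) i) 0"
      unfolding w_def coeff_sum coeff_smult by (simp add: coeff_sum del: power_Suc)
  qed
qed

section \<open>The generic rank\<close>

lemma zariski_dense_sums_of_powers_iff:
  assumes "k \<ge> 1"
  shows "zariski_dense (k * d) (sums_of_powers k d s) \<longleftrightarrow> k * d + 1 \<le> s * (d + 1)"
  using sums_of_powers_dense[OF assms, of d s] sums_of_powers_not_dense[of s d k] by linarith

theorem theorem2p3:
  fixes k d :: nat
  assumes "k \<ge> 2" and "d \<ge> 2"
  shows "int (generic_rank k d) = \<lceil>real (k * d + 1) / real (d + 1)\<rceil>"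
proof -
  define r where "r = \<lceil>real (k * d + 1) / real (d + 1)\<rceil>"
  have "zariski_dense (k * d) (sums_of_powers k d s) \<longleftrightarrow> r \<le> int s" for s
  proof -
    have "r \<le> int s \<longleftrightarrow> real (k * d + 1) \<le> real s * real (d + 1)"
      by (simp add: r_def ceiling_le_iff divide_le_eq del: of_nat_add of_nat_mult)
    also have "\<dots> \<longleftrightarrow> k * d + 1 \<le> s * (d + 1)"
      by (simp only: of_nat_le_iff flip: of_nat_mult)
    finally show ?thesis
      using assms(1) zariski_dense_sums_of_powers_iff[of k d s] by simp
  qed
  then have "generic_rank k d = nat r"
    unfolding generic_rank_def by (intro Least_equality) auto
  moreover have "0 \<le> r"
    unfolding r_def by (subst zero_le_ceiling) (rule less_le_trans[of _ 0], auto)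
  ultimately show ?thesis by (simp add: r_def)
qed

end
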